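(* There exists a semi-total coloring (sTC) $\mu$ of the $(5,6)$-cage $G$ that yields a decomposition of $G$ into 3 copies of the Heawood graph and 7 copies of the 6-cycle as follows: the edges of $G$ whose two endvertices have the same color under $\mu$ form the disjoint union of three copies of the Heawood graph, and the remaining edges of $G$ form the disjoint union of seven 6-cycles.
   Context: The $(5,6)$-cage is the 5-regular graph of girth 6 on 42 vertices (the incidence graph of the points and lines of the projective plane of order 4). The Heawood graph is the 14-vertex cubic graph of girth 6 (the incidence graph of the points and lines of the Fano plane). For a connected simple graph $G$ with maximum degree $\Delta$, a semi-total coloring (sTC) is a function $\mu$ from $V(G)\cup E(G)$ to a set of $\Delta+1$ colors such that every two adjacent edges have distinct colors and every vertex has a color distinct from the colors of its incident edges (adjacent vertices may have equal colors). For the $(5,6)$-cage, $\Delta=5$, so six colors are available. *)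

theory Defs
  imports "HOL-Analysis.Analysis" "HOL-Library.Z2"
begin

section \<open>Finite simple graphs\<close>

record 'a graph =
  verts :: "'a set"
  edges :: "'a set set"

definition simple_graph :: "'a graph \<Rightarrow> bool" where
  "simple_graph G \<longleftrightarrow> finite (verts G) \<and> (\<forall>e\<in>edges G. e \<subseteq> verts G \<and> card e = 2)"

definition vertex_degree :: "'a graph \<Rightarrow> 'a \<Rightarrow> nat" where
  "vertex_degree G v = card {e \<in> edges G. v \<in> e}"

definition max_degree :: "'a graph \<Rightarrow> nat" where
  "max_degree G = Max (vertex_degree G ` verts G)"

definition regular :: "'a graph \<Rightarrow> nat \<Rightarrow> bool" where
  "regular G k \<longleftrightarrow> (\<forall>v\<in>verts G. vertex_degree G v = k)"

definition connected_graph :: "'a graph \<Rightarrow> bool" where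
  "connected_graph G \<longleftrightarrow> (\<forall>u\<in>verts G. \<forall>v\<in>verts G. (u, v) \<in> {(x, y). {x, y} \<in> edges G}\<^sup>*)"

definition is_cycle :: "'a graph \<Rightarrow> 'a list \<Rightarrow> bool" where
  "is_cycle G xs \<longleftrightarrow> length xs \<ge> 3 \<and> distinct xs \<and>
     (\<forall>i<length xs. {xs ! i, xs ! (Suc i mod length xs)} \<in> edges G)"

text \<open>Only meaningful for graphs that contain a cycle.\<close>

definition girth :: "'a graph \<Rightarrow> nat" where
  "girth G = (LEAST n. \<exists>xs. is_cycle G xs \<and> length xs = n)"

definition graph_iso :: "'a graph \<Rightarrow> 'b graph \<Rightarrow> bool" where
  "graph_iso G H \<longleftrightarrow> (\<exists>f. bij_betw f (verts G) (verts H) \<and> edges H = (`) f ` edges G)"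

definition cycle_graph :: "nat \<Rightarrow> nat graph" where
  "cycle_graph n = \<lparr>verts = {..<n}, edges = {{i, Suc i mod n} | i. i < n}\<rparr>"

definition edge_induced :: "'a set set \<Rightarrow> 'a graph" where
  "edge_induced F = \<lparr>verts = \<Union>F, edges = F\<rparr>"

definition disjoint_copies :: "nat \<Rightarrow> 'b graph \<Rightarrow> 'a graph \<Rightarrow> bool" where
  "disjoint_copies n H G \<longleftrightarrow> (\<exists>K :: nat \<Rightarrow> 'a graph.
     (\<forall>i<n. graph_iso (K i) H) \<and>
     disjoint_family_on (\<lambda>i. verts (K i)) {..<n} \<and>
     verts G = (\<Union>i<n. verts (K i)) \<and>
     edges G = (\<Union>i<n. edges (K i)))"


section \<open>Semi-total colorings\<close>

text \<open>
  A coloring of vertices and edges is a function on the disjoint sum: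
  \<open>\<mu> (Inl v)\<close> is the color of the vertex \<open>v\<close>, \<open>\<mu> (Inr e)\<close> that of the edge \<open>e\<close>.
\<close>

definition semi_total_coloring :: "'a graph \<Rightarrow> ('a + 'a set \<Rightarrow> nat) \<Rightarrow> bool" where
  "semi_total_coloring G \<mu> \<longleftrightarrow>
     \<mu> \<in> (verts G <+> edges G) \<rightarrow> {..<max_degree G + 1} \<and>
     (\<forall>e\<in>edges G. \<forall>f\<in>edges G. e \<noteq> f \<and> e \<inter> f \<noteq> {} \<longrightarrow> \<mu> (Inr e) \<noteq> \<mu> (Inr f)) \<and>
     (\<forall>v\<in>verts G. \<forall>e\<in>edges G. v \<in> e \<longrightarrow> \<mu> (Inl v) \<noteq> \<mu> (Inr e))"

definition equal_end_edges :: "'a graph \<Rightarrow> ('a + 'a set \<Rightarrow> nat) \<Rightarrow> 'a set set" where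
  "equal_end_edges G \<mu> = {e \<in> edges G. \<forall>u\<in>e. \<forall>v\<in>e. \<mu> (Inl u) = \<mu> (Inl v)}"


section \<open>The field with four elements\<close>

text \<open>\<open>GF4 a b\<close> stands for \<open>a + b * w\<close> in \<open>F\<^sub>2[w] / (w\<^sup>2 + w + 1)\<close>.\<close>

datatype gf4 = GF4 bit bit

instantiation gf4 :: field
begin

definition zero_gf4 :: gf4 where "0 = GF4 0 0"

definition one_gf4 :: gf4 where "1 = GF4 1 0"

fun plus_gf4 :: "gf4 \<Rightarrow> gf4 \<Rightarrow> gf4" where
  "GF4 a b + GF4 c d = GF4 (a + c) (b + d)"

fun times_gf4 :: "gf4 \<Rightarrow> gf4 \<Rightarrow> gf4" where
  "GF4 a b * GF4 c d = GF4 (a * c + b * d) (a * d + b * c + b * d)"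

definition uminus_gf4 :: "gf4 \<Rightarrow> gf4" where "- x = (x :: gf4)"

definition minus_gf4 :: "gf4 \<Rightarrow> gf4 \<Rightarrow> gf4" where "x - y = (x + y :: gf4)"

text \<open>Every nonzero element satisfies \<open>x\<^sup>3 = 1\<close>.\<close>

definition inverse_gf4 :: "gf4 \<Rightarrow> gf4" where "inverse x = (x * x :: gf4)"

definition divide_gf4 :: "gf4 \<Rightarrow> gf4 \<Rightarrow> gf4" where "x div y = (x * inverse y :: gf4)"

instance
proof
  fix a b c :: gf4
  obtain a1 a2 b1 b2 c1 c2 where eqs: "a = GF4 a1 a2" "b = GF4 b1 b2" "c = GF4 c1 c2"
    by (metis gf4.exhaust)
  note defs = zero_gf4_def one_gf4_def uminus_gf4_def minus_gf4_def inverse_gf4_def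
    divide_gf4_def eqs
  show "a * b * c = a * (b * c)"
    by (cases a1; cases a2; cases b1; cases b2; cases c1; cases c2) (simp_all add: defs)
  show "a * b = b * a"
    by (cases a1; cases a2; cases b1; cases b2) (simp_all add: defs)
  show "1 * a = a" by (simp add: defs)
  show "a + b + c = a + (b + c)"
    by (cases a1; cases a2; cases b1; cases b2; cases c1; cases c2) (simp_all add: defs)
  show "a + b = b + a"
    by (cases a1; cases a2; cases b1; cases b2) (simp_all add: defs)
  show "0 + a = a" by (simp add: defs)
  show "- a + a = 0" by (cases a1; cases a2) (simp_all add: defs)
  show "a - b = a + - b" by (simp add: defs)
  show "(a + b) * c = a * c + b * c"
    by (cases a1; cases a2; cases b1; cases b2; cases c1; cases c2) (simp_all add: defs)
  show "(0::gf4) \<noteq> 1" by (simp add: defs)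
  show "a \<noteq> 0 \<Longrightarrow> inverse a * a = 1"
    by (cases a1; cases a2) (simp_all add: defs)
  show "a div b = a * inverse b" by (simp add: divide_gf4_def)
  show "inverse (0::gf4) = 0" by (simp add: defs)
qed

end

lemma UNIV_bit: "(UNIV :: bit set) = {0, 1}"
  by auto

instance bit :: finite
  by standard (simp add: UNIV_bit)

lemma CARD_bit: "CARD(bit) = 2"
  by (simp add: UNIV_bit)

lemma UNIV_gf4: "(UNIV :: gf4 set) = {GF4 0 0, GF4 1 0, GF4 0 1, GF4 1 1}"
proof -
  have "x \<in> {GF4 0 0, GF4 1 0, GF4 0 1, GF4 1 1}" for x
  proof (cases x)
    case (GF4 a b)
    then show ?thesis by (cases a; cases b) simp_all
  qed
  then show ?thesis by blast
qed

instance gf4 :: finite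
  by standard (simp add: UNIV_gf4)

lemma CARD_gf4: "CARD(gf4) = 4"
  by (simp add: UNIV_gf4)


section \<open>Desarguesian projective planes and their incidence graphs\<close>

definition pg2_points :: "('a::field ^ 3) set set" where
  "pg2_points = {P. vec.subspace P \<and> vec.dim P = 1}"

definition pg2_lines :: "('a::field ^ 3) set set" where
  "pg2_lines = {L. vec.subspace L \<and> vec.dim L = 2}"

definition pg2_incidence_graph :: "('a::field ^ 3) set graph" where
  "pg2_incidence_graph =
     \<lparr>verts = pg2_points \<union> pg2_lines,
      edges = {{P, L} | P L. P \<in> pg2_points \<and> L \<in> pg2_lines \<and> P \<subseteq> L}\<rparr>"

definition heawood_graph :: "(bit ^ 3) set graph" where
  "heawood_graph = pg2_incidence_graph"

definition cage_5_6 :: "(gf4 ^ 3) set graph" where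
  "cage_5_6 = pg2_incidence_graph"


section \<open>Orders, degrees and girths of the incidence graphs\<close>

lemma card_dim_1:
  fixes P :: "('a::{field,finite} ^ 3) set"
  assumes "vec.subspace P" "vec.dim P = 1"
  shows "card P = CARD('a)"
proof -
  obtain B where B: "B \<subseteq> P" "vec.independent B" "P \<subseteq> vec.span B" "card B = vec.dim P"
    using vec.basis_exists by blast
  then obtain v where v: "B = {v}" using assms(2) by (metis card_1_singletonE)
  have "v \<noteq> 0" using B v by (metis vec.dependent_zero singletonI)
  moreover have "P = range (\<lambda>c. c *s v)"
    using B v assms(1) vec.span_minimal[of B P] by (auto simp: vec.span_singleton)
  ultimately show ?thesis by (simp add: card_image inj_on_def)
qed

lemma card_dim_2:
  fixes L :: "('a::{field,finite} ^ 3) set"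
  assumes "vec.subspace L" "vec.dim L = 2"
  shows "card L = CARD('a) ^ 2"
proof -
  obtain B where B: "B \<subseteq> L" "vec.independent B" "L \<subseteq> vec.span B" "card B = vec.dim L"
    using vec.basis_exists by blast
  then obtain v w where v: "B = {v, w}" "v \<noteq> w" using assms(2) by (metis card_2_iff)
  have ind: "c = 0 \<and> d = 0" if "c *s v + d *s w = 0" for c d
  proof -
    have "\<forall>u. (\<Sum>x\<in>B. u x *s x) = 0 \<longrightarrow> (\<forall>x\<in>B. u x = 0)"
      using B(2) v(1) vec.independentD[of B B] by (auto simp: v)
    from this[rule_format, of "\<lambda>x. if x = v then c else d" v]
      this[rule_format, of "\<lambda>x. if x = v then c else d" w]
    show ?thesis using that v by auto
  qed
  have "inj (\<lambda>(c, d). c *s v + d *s w)"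
  proof (rule injI, clarify)
    fix c d c' d' assume "c *s v + d *s w = c' *s v + d' *s w"
    then have "(c - c') *s v + (d - d') *s w = 0"
      by (simp add: vec.scale_left_diff_distrib algebra_simps)
    then show "c = c' \<and> d = d'" using ind by fastforce
  qed
  moreover have "vec.span B = range (\<lambda>(c, d). c *s v + d *s w)"
    unfolding v by (auto simp: vec.span_insert vec.span_singleton image_iff algebra_simps)
  moreover have "L = vec.span B"
    using B assms(1) vec.span_minimal[of B L] by auto
  ultimately show ?thesis by (simp add: card_image power2_eq_square flip: UNIV_Times_UNIV)
qed

lemma pg2_point_unique:
  assumes "v \<noteq> (0 :: 'a::field ^ 3)"
  shows "vec.span {v} \<in> pg2_points"
    and "P \<in> pg2_points \<Longrightarrow> v \<in> P \<Longrightarrow> P = vec.span {v}"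
proof -
  show "vec.span {v} \<in> pg2_points" using assms by (simp add: pg2_points_def)
  assume "P \<in> pg2_points" "v \<in> P"
  then show "P = vec.span {v}"
    using vec.subspace_dim_equal[of "vec.span {v}" P] vec.span_minimal[of "{v}" P] assms
    by (simp add: pg2_points_def)
qed

lemma pg2_line_unique:
  assumes "P \<in> pg2_points" "(v :: 'a::field ^ 3) \<notin> P"
  shows "vec.span (insert v P) \<in> pg2_lines"
    and "L \<in> pg2_lines \<Longrightarrow> P \<subseteq> L \<Longrightarrow> v \<in> L \<Longrightarrow> L = vec.span (insert v P)"
proof -
  have "vec.subspace P" "vec.dim P = 1" using assms(1) by (auto simp: pg2_points_def)
  moreover then have "v \<notin> vec.span P" using assms(2) vec.span_eq_iff by metis
  ultimately have dim: "vec.dim (vec.span (insert v P)) = 2" by (simp add: vec.dim_insert)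
  then show "vec.span (insert v P) \<in> pg2_lines" by (simp add: pg2_lines_def)
  assume "L \<in> pg2_lines" "P \<subseteq> L" "v \<in> L"
  then show "L = vec.span (insert v P)"
    using vec.subspace_dim_equal[of "vec.span (insert v P)" L] vec.span_minimal[of "insert v P" L] dim
    by (simp add: pg2_lines_def)
qed

lemma pg2_zero_mem:
  "P \<in> pg2_points \<Longrightarrow> 0 \<in> P" "L \<in> pg2_lines \<Longrightarrow> 0 \<in> L"
  by (auto simp: pg2_points_def pg2_lines_def vec.subspace_0)

lemma pg2_points_lines_disjoint: "pg2_points \<inter> pg2_lines = {}"
  by (auto simp: pg2_points_def pg2_lines_def)

lemma pg2_point_cases:
  assumes "P \<in> pg2_points"
  obtains v where "v \<noteq> 0" "v \<in> P" "P = vec.span {v}"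
proof -
  have "P \<noteq> {0}" using assms by (auto simp: pg2_points_def)
  with pg2_zero_mem(1)[OF assms] obtain v where "v \<in> P" "v \<noteq> 0" by blast
  with that pg2_point_unique(2) assms show thesis by blast
qed

lemma pg2_common_line_unique:
  assumes "P \<in> pg2_points" "Q \<in> pg2_points" "P \<noteq> Q"
    and "L \<in> pg2_lines" "M \<in> pg2_lines" "P \<subseteq> L" "Q \<subseteq> L" "P \<subseteq> M" "Q \<subseteq> M"
  shows "L = M"
proof -
  obtain v where "v \<noteq> 0" "v \<in> Q" "Q = vec.span {v}" using pg2_point_cases assms(2) by blast
  moreover then have "v \<notin> P" using pg2_point_unique(2) assms(1,3) by blast
  ultimately show ?thesis using pg2_line_unique(2)[OF assms(1), of v] assms by blast
qed

lemma pg2_common_line: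
  assumes "P \<in> pg2_points" "Q \<in> pg2_points"
  obtains L where "L \<in> pg2_lines" "P \<subseteq> L" "Q \<subseteq> L"
proof -
  obtain v where v: "v \<noteq> 0" "v \<in> Q" "Q = vec.span {v}" using pg2_point_cases assms(2) by blast
  obtain w where w: "w \<notin> P"
  proof -
    have "P \<noteq> UNIV" using assms(1) by (auto simp: pg2_points_def vec.dim_UNIV card_cart_basis)
    then show thesis using that by blast
  qed
  define u where "u = (if v \<in> P then w else v)"
  have "u \<notin> P" using w by (simp add: u_def)
  moreover have "Q \<subseteq> vec.span (insert u P)"
    using v vec.span_mono[of "{v}" "insert u P"] by (auto simp: u_def)
  ultimately show thesis using that pg2_line_unique(1)[OF assms(1)] vec.span_superset by blast
qed

context
  fixes q :: nat
  defines "q \<equiv> CARD('a::{field,finite})"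
begin

lemma field_card_ge_2: "q \<ge> 2"
proof -
  have "card {0, 1 :: 'a} \<le> q" unfolding q_def by (rule card_mono) auto
  then show ?thesis by simp
qed

lemma card_pg2_points: "card (pg2_points :: ('a ^ 3) set set) = q ^ 2 + q + 1"
proof -
  let ?C = "(\<lambda>P. P - {0}) ` (pg2_points :: ('a ^ 3) set set)"
  have inj: "inj_on (\<lambda>P. P - {0}) (pg2_points :: ('a ^ 3) set set)"
    by (rule inj_onI) (metis insert_Diff pg2_zero_mem(1))
  have U: "\<Union>?C = UNIV - {0}"
    using pg2_point_unique(1) by (auto intro: vec.span_base)
  have "(q - 1) * card ?C = card (\<Union>?C)"
  proof (rule card_partition)
    show "card c = q - 1" if "c \<in> ?C" for c
      using that card_dim_1[where 'a = 'a] pg2_zero_mem(1)[where 'a = 'a] by (auto simp: pg2_points_def q_def)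
    show "c1 \<inter> c2 = {}" if "c1 \<in> ?C" "c2 \<in> ?C" "c1 \<noteq> c2" for c1 c2
    proof (rule ccontr)
      assume "c1 \<inter> c2 \<noteq> {}"
      then obtain v where "v \<in> c1" "v \<in> c2" by blast
      then show False using that pg2_point_unique(2)[of v] by auto
    qed
  qed auto
  also have "\<dots> = q ^ 3 - 1" unfolding U by (simp add: q_def)
  finally have "(q - 1) * card (pg2_points :: ('a ^ 3) set set) = q ^ 3 - 1"
    using inj by (simp add: card_image)
  moreover have "(q - 1) * (q ^ 2 + q + 1) = q ^ 3 - 1"
    by (cases q) (auto simp: algebra_simps power2_eq_square power3_eq_cube)
  moreover have "q - 1 \<noteq> 0" using field_card_ge_2 by simp
  ultimately show ?thesis by (metis mult_cancel_left)
qed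

lemma card_pg2_points_on_line:
  assumes "L \<in> (pg2_lines :: ('a ^ 3) set set)"
  shows "card {P \<in> pg2_points. P \<subseteq> L} = q + 1"
proof -
  let ?D = "{P \<in> pg2_points. P \<subseteq> L}"
  let ?C = "(\<lambda>P. P - {0}) ` ?D"
  have inj: "inj_on (\<lambda>P. P - {0}) ?D"
    by (rule inj_onI) (metis (no_types, lifting) insert_Diff mem_Collect_eq pg2_zero_mem(1))
  have "vec.subspace L" using assms by (simp add: pg2_lines_def)
  then have "v \<in> \<Union>?C" if "v \<in> L" "v \<noteq> 0" for v
    using that pg2_point_unique(1)[of v] vec.span_minimal[of "{v}" L] vec.span_base[of v "{v}"]
    by auto
  then have U: "\<Union>?C = L - {0}" by auto
  have "(q - 1) * card ?C = card (\<Union>?C)"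
  proof (rule card_partition)
    show "card c = q - 1" if "c \<in> ?C" for c
      using that card_dim_1[where 'a = 'a] pg2_zero_mem(1)[where 'a = 'a] by (auto simp: pg2_points_def q_def)
    show "c1 \<inter> c2 = {}" if "c1 \<in> ?C" "c2 \<in> ?C" "c1 \<noteq> c2" for c1 c2
    proof (rule ccontr)
      assume "c1 \<inter> c2 \<noteq> {}"
      then obtain v where "v \<in> c1" "v \<in> c2" by blast
      then show False using that pg2_point_unique(2)[of v] by auto
    qed
  qed auto
  also have "\<dots> = q ^ 2 - 1"
    unfolding U using assms pg2_zero_mem(2)[OF assms] card_dim_2[of L] by (simp add: q_def pg2_lines_def)
  finally have "(q - 1) * card ?D = q ^ 2 - 1"
    using inj by (simp add: card_image)
  moreover have "(q - 1) * (q + 1) = q ^ 2 - 1"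
    by (cases q) (auto simp: algebra_simps power2_eq_square)
  moreover have "q - 1 \<noteq> 0" using field_card_ge_2 by simp
  ultimately show ?thesis by (metis mult_cancel_left)
qed

lemma card_pg2_lines_through_point:
  assumes "P \<in> (pg2_points :: ('a ^ 3) set set)"
  shows "card {L \<in> pg2_lines. P \<subseteq> L} = q + 1"
proof -
  let ?D = "{L \<in> pg2_lines. P \<subseteq> L}"
  let ?C = "(\<lambda>L. L - P) ` ?D"
  have inj: "inj_on (\<lambda>L. L - P) ?D"
    by (rule inj_onI) blast
  have cP: "card P = q" using assms card_dim_1 by (auto simp: pg2_points_def q_def)
  have "v \<in> \<Union>?C" if "v \<notin> P" for v
    using that pg2_line_unique(1)[OF assms that] vec.span_superset[of "insert v P"]
    by blast
  then have U: "\<Union>?C = UNIV - P" by auto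
  have "(q ^ 2 - q) * card ?C = card (\<Union>?C)"
  proof (rule card_partition)
    show "card c = q ^ 2 - q" if "c \<in> ?C" for c
      using that card_dim_2[where 'a = 'a] cP by (auto simp: pg2_lines_def q_def card_Diff_subset)
    show "c1 \<inter> c2 = {}" if "c1 \<in> ?C" "c2 \<in> ?C" "c1 \<noteq> c2" for c1 c2
    proof (rule ccontr)
      assume "c1 \<inter> c2 \<noteq> {}"
      then obtain v where "v \<in> c1" "v \<in> c2" by blast
      then show False using that pg2_line_unique(2)[OF assms, of v] by auto
    qed
  qed auto
  also have "\<dots> = q ^ 3 - q"
    unfolding U using cP by (simp add: q_def card_Diff_subset)
  finally have "(q ^ 2 - q) * card ?D = q ^ 3 - q"
    using inj by (simp add: card_image)
  moreover have "(q ^ 2 - q) * (q + 1) = q ^ 3 - q"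
    by (cases q) (auto simp: algebra_simps power2_eq_square power3_eq_cube)
  moreover have "q ^ 2 - q \<noteq> 0" using field_card_ge_2 by (cases q) (auto simp: power2_eq_square)
  ultimately show ?thesis by (metis mult_cancel_left)
qed

lemma card_pg2_lines: "card (pg2_lines :: ('a ^ 3) set set) = q ^ 2 + q + 1"
proof -
  have "(\<Sum>L\<in>(pg2_lines :: ('a ^ 3) set set). card {P \<in> pg2_points. P \<subseteq> L}) = (q + 1) * card (pg2_points :: ('a ^ 3) set set)"
    using sum_multicount[of "pg2_lines :: ('a ^ 3) set set" "pg2_points :: ('a ^ 3) set set"
        "\<lambda>L P. P \<subseteq> L" "q + 1"] card_pg2_lines_through_point by simp
  then have "card (pg2_lines :: ('a ^ 3) set set) * (q + 1) = (q + 1) * (q ^ 2 + q + 1)"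
    by (simp add: card_pg2_points_on_line card_pg2_points del: mult_Suc mult_Suc_right)
  then show ?thesis by (simp add: mult.commute del: mult_Suc mult_Suc_right)
qed

lemma card_verts_pg2_incidence_graph:
  "card (verts (pg2_incidence_graph :: ('a ^ 3) set graph)) = 2 * (q ^ 2 + q + 1)"
  by (simp add: pg2_incidence_graph_def card_Un_disjoint pg2_points_lines_disjoint
      card_pg2_points card_pg2_lines)

lemma regular_pg2_incidence_graph:
  "regular (pg2_incidence_graph :: ('a ^ 3) set graph) (q + 1)"
proof -
  let ?G = "pg2_incidence_graph :: ('a ^ 3) set graph"
  have P: "vertex_degree ?G P = q + 1" if P: "P \<in> pg2_points" for P
  proof -
    have ni: "P \<notin> pg2_lines" using P pg2_points_lines_disjoint by blast
    have "{e \<in> edges ?G. P \<in> e} = (\<lambda>L. {P, L}) ` {L \<in> pg2_lines. P \<subseteq> L}"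
      using P ni by (auto simp: pg2_incidence_graph_def)
    moreover have "inj_on (\<lambda>L. {P, L}) {L \<in> pg2_lines. P \<subseteq> L}"
      by (auto simp: inj_on_def doubleton_eq_iff)
    ultimately show ?thesis by (simp add: vertex_degree_def card_image card_pg2_lines_through_point[OF P])
  qed
  have L: "vertex_degree ?G L = q + 1" if L: "L \<in> pg2_lines" for L
  proof -
    have ni: "L \<notin> pg2_points" using L pg2_points_lines_disjoint by blast
    have "{e \<in> edges ?G. L \<in> e} = (\<lambda>P. {P, L}) ` {P \<in> pg2_points. P \<subseteq> L}"
      using L ni by (auto simp: pg2_incidence_graph_def)
    moreover have "inj_on (\<lambda>P. {P, L}) {P \<in> pg2_points. P \<subseteq> L}"
      by (auto simp: inj_on_def doubleton_eq_iff)
    ultimately show ?thesis by (simp add: vertex_degree_def card_image card_pg2_points_on_line[OF L])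
  qed
  show ?thesis unfolding regular_def using P L by (auto simp: pg2_incidence_graph_def)
qed

end

lemma simple_graph_pg2_incidence_graph:
  "simple_graph (pg2_incidence_graph :: ('a::{field,finite} ^ 3) set graph)"
proof -
  have "card {P, L} = 2" if "P \<in> pg2_points" "L \<in> pg2_lines" for P L :: "('a ^ 3) set"
    using that pg2_points_lines_disjoint by (metis IntI card_2_iff empty_iff)
  then show ?thesis by (auto simp: simple_graph_def pg2_incidence_graph_def)
qed

lemma pg2_edge_iff:
  "{x, y} \<in> edges pg2_incidence_graph \<longleftrightarrow>
     x \<in> pg2_points \<and> y \<in> pg2_lines \<and> x \<subseteq> y \<or> y \<in> pg2_points \<and> x \<in> pg2_lines \<and> y \<subseteq> x"
  by (auto simp: pg2_incidence_graph_def doubleton_eq_iff)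

lemma connected_pg2_incidence_graph:
  "connected_graph (pg2_incidence_graph :: ('a::field ^ 3) set graph)"
proof -
  let ?R = "{(x, y). {x, y} \<in> edges (pg2_incidence_graph :: ('a ^ 3) set graph)}"
  have sym: "(y, x) \<in> ?R" if "(x, y) \<in> ?R" for x y
    using that by (simp add: insert_commute)
  have PP: "(P, Q) \<in> ?R\<^sup>*" if PQ: "P \<in> pg2_points" "Q \<in> pg2_points" for P Q
  proof -
    obtain L where "L \<in> pg2_lines" "P \<subseteq> L" "Q \<subseteq> L" using pg2_common_line[OF PQ] by blast
    with PQ have "(P, L) \<in> ?R" "(L, Q) \<in> ?R" by (auto simp: pg2_edge_iff)
    then show ?thesis by (meson r_into_rtrancl rtrancl_trans)
  qed
  have ex: "\<exists>P\<in>pg2_points. (x, P) \<in> ?R\<^sup>* \<and> (P, x) \<in> ?R\<^sup>*"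
    if "x \<in> verts pg2_incidence_graph" for x
  proof (cases "x \<in> pg2_points")
    case False
    then have x: "x \<in> pg2_lines" using that by (simp add: pg2_incidence_graph_def)
    then have s: "vec.subspace x" and "x \<noteq> {0}" by (auto simp: pg2_lines_def)
    with pg2_zero_mem(2)[OF x] obtain v where v: "v \<in> x" "v \<noteq> 0" by blast
    then have "vec.span {v} \<in> pg2_points" "vec.span {v} \<subseteq> x"
      using pg2_point_unique(1) vec.span_minimal[of "{v}" x] s by auto
    moreover with x have "(vec.span {v}, x) \<in> ?R" by (simp add: pg2_edge_iff)
    ultimately show ?thesis using sym by blast
  qed auto
  show ?thesis unfolding connected_graph_def
  proof (intro ballI)
    fix x y assume "x \<in> verts (pg2_incidence_graph :: ('a ^ 3) set graph)"
      "y \<in> verts (pg2_incidence_graph :: ('a ^ 3) set graph)"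
    then obtain P Q where "P \<in> pg2_points" "Q \<in> pg2_points" "(x, P) \<in> ?R\<^sup>*" "(Q, y) \<in> ?R\<^sup>*"
      using ex by meson
    then show "(x, y) \<in> ?R\<^sup>*" using PP[of P Q] by (meson rtrancl_trans)
  qed
qed

lemma girth_pg2_incidence_graph:
  "girth (pg2_incidence_graph :: ('a::field ^ 3) set graph) = 6"
  unfolding girth_def
proof (rule Least_equality)
  let ?G = "pg2_incidence_graph :: ('a ^ 3) set graph"
  note disj = pg2_points_lines_disjoint[where 'a = 'a]
  show "\<exists>xs. is_cycle ?G xs \<and> length xs = 6"
  proof -
    define v :: "'a ^ 3" where "v = axis 1 1"
    have "v \<noteq> 0" by (simp add: v_def)
    define P where "P = vec.span {v}"
    have P: "P \<in> pg2_points" using pg2_point_unique(1) \<open>v \<noteq> 0\<close> by (simp add: P_def)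
    obtain w where w: "w \<notin> P"
    proof -
      have "P \<noteq> UNIV" using P by (auto simp: pg2_points_def vec.dim_UNIV card_cart_basis)
      then show thesis using that by blast
    qed
    then have w0: "w \<noteq> 0" using pg2_zero_mem(1)[OF P] by blast
    define Q where "Q = vec.span {w}"
    have Q: "Q \<in> pg2_points" "w \<in> Q" using pg2_point_unique(1) w0 by (simp_all add: Q_def vec.span_base)
    obtain L where L: "L \<in> pg2_lines" "P \<subseteq> L" "Q \<subseteq> L" using pg2_common_line[OF P Q(1)] by blast
    obtain u where u: "u \<notin> L"
    proof -
      have "L \<noteq> UNIV" using L by (auto simp: pg2_lines_def vec.dim_UNIV card_cart_basis)
      then show thesis using that by blast
    qed
    then have u0: "u \<noteq> 0" using pg2_zero_mem(2)[OF L(1)] by blast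
    define R where "R = vec.span {u}"
    have R: "R \<in> pg2_points" "u \<in> R" using pg2_point_unique(1) u0 by (simp_all add: R_def vec.span_base)
    obtain M where M: "M \<in> pg2_lines" "Q \<subseteq> M" "R \<subseteq> M" using pg2_common_line[OF Q(1) R(1)] by blast
    obtain N where N: "N \<in> pg2_lines" "R \<subseteq> N" "P \<subseteq> N" using pg2_common_line[OF R(1) P] by blast
    have PQ: "P \<noteq> Q" using w Q by blast
    have "\<not> R \<subseteq> L" using u R by blast
    then have "L \<noteq> M" "L \<noteq> N" "P \<noteq> R" "Q \<noteq> R" using L M N by blast+
    moreover then have "M \<noteq> N"
      using pg2_common_line_unique[OF P Q(1) PQ L(1) M(1)] L M N by blast
    moreover have "{P, Q, R} \<inter> {L, M, N} = {}"
    proof -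
      have "{P, Q, R} \<subseteq> pg2_points" "{L, M, N} \<subseteq> pg2_lines" using P Q(1) R(1) L(1) M(1) N(1) by simp_all
      then show ?thesis using disj by blast
    qed
    then have "P \<noteq> L \<and> P \<noteq> M \<and> P \<noteq> N \<and> Q \<noteq> L \<and> Q \<noteq> M \<and> Q \<noteq> N \<and> R \<noteq> L \<and> R \<noteq> M \<and> R \<noteq> N"
      by blast
    ultimately have "distinct [P, L, Q, M, R, N]"
      unfolding distinct.simps list.set using PQ by blast
    moreover have "\<forall>i<6. {[P, L, Q, M, R, N] ! i, [P, L, Q, M, R, N] ! (Suc i mod 6)} \<in> edges ?G"
    proof (intro allI impI)
      fix i :: nat assume "i < 6"
      have e: "{P, L} \<in> edges ?G" "{L, Q} \<in> edges ?G" "{Q, M} \<in> edges ?G"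
        "{M, R} \<in> edges ?G" "{R, N} \<in> edges ?G" "{N, P} \<in> edges ?G"
        unfolding pg2_edge_iff using P Q(1) R(1) L M N by blast+
      consider "i = 0" | "i = 1" | "i = 2" | "i = 3" | "i = 4" | "i = 5"
        using \<open>i < 6\<close> by linarith
      then show "{[P, L, Q, M, R, N] ! i, [P, L, Q, M, R, N] ! (Suc i mod 6)} \<in> edges ?G"
        using e by cases simp_all
    qed
    ultimately have "is_cycle ?G [P, L, Q, M, R, N]" by (simp add: is_cycle_def)
    then show ?thesis by (intro exI[of _ "[P, L, Q, M, R, N]"]) simp
  qed
  show "6 \<le> n" if cyc: "\<exists>xs. is_cycle ?G xs \<and> length xs = n" for n
  proof (rule ccontr)
    assume "\<not> 6 \<le> n"
    obtain xs where xs: "is_cycle ?G xs" "length xs = n" using cyc by blast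
    have e: "{xs ! i, xs ! (Suc i mod n)} \<in> edges ?G" if "i < n" for i
      using xs that by (simp add: is_cycle_def)
    have bip: "x \<in> pg2_points \<and> y \<in> pg2_lines \<or> y \<in> pg2_points \<and> x \<in> pg2_lines"
      if "{x, y} \<in> edges ?G" for x y using that by (auto simp: pg2_edge_iff)
    have "n \<ge> 3" using xs by (simp add: is_cycle_def)
    with \<open>\<not> 6 \<le> n\<close> consider "n = 3" | "n = 4" | "n = 5" by linarith
    then show False
    proof cases
      case 1
      then obtain a b c where "xs = [a, b, c]"
        using xs by (auto simp: length_Suc_conv numeral_eq_Suc)
      then have "{a, b} \<in> edges ?G" "{b, c} \<in> edges ?G" "{c, a} \<in> edges ?G"
        using e[of 0] e[of 1] e[of 2] 1 by simp_all
      then show False using bip disj by blast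
    next
      case 2
      then obtain a b c d where abcd: "xs = [a, b, c, d]"
        using xs by (auto simp: length_Suc_conv numeral_eq_Suc)
      then have e: "{a, b} \<in> edges ?G" "{b, c} \<in> edges ?G" "{c, d} \<in> edges ?G" "{d, a} \<in> edges ?G"
        using e[of 0] e[of 1] e[of 2] e[of 3] 2 by simp_all
      have ne: "a \<noteq> c" "b \<noteq> d" using xs abcd by (auto simp: is_cycle_def)
      show False
      proof (cases "a \<in> pg2_points")
        case True
        then have "a \<notin> pg2_lines" using disj by blast
        with True e disj have "b \<in> pg2_lines" "d \<in> pg2_lines" "c \<in> pg2_points"
          "a \<subseteq> b" "a \<subseteq> d" "c \<subseteq> b" "c \<subseteq> d"
          unfolding pg2_edge_iff by blast+
        then show False using pg2_common_line_unique[of a c b d] True ne by blast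
      next
        case False
        with e disj have "a \<in> pg2_lines" "c \<in> pg2_lines" "b \<in> pg2_points" "d \<in> pg2_points"
          "b \<subseteq> a" "d \<subseteq> a" "b \<subseteq> c" "d \<subseteq> c"
          unfolding pg2_edge_iff by blast+
        then show False using pg2_common_line_unique[of b d a c] ne by blast
      qed
    next
      case 3
      then obtain a b c d f where "xs = [a, b, c, d, f]"
        using xs by (auto simp: length_Suc_conv numeral_eq_Suc)
      then have "{a, b} \<in> edges ?G" "{b, c} \<in> edges ?G" "{c, d} \<in> edges ?G" "{d, f} \<in> edges ?G"
        "{f, a} \<in> edges ?G"
        using e[of 0] e[of 1] e[of 2] e[of 3] e[of 4] 3 by simp_all
      then show False using bip disj by blast
    qed
  qed
qed

lemma heawood_graph_properties:
  "simple_graph heawood_graph" "connected_graph heawood_graph"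
  "card (verts heawood_graph) = 14" "regular heawood_graph 3" "girth heawood_graph = 6"
  using card_verts_pg2_incidence_graph[where 'a = bit] regular_pg2_incidence_graph[where 'a = bit]
  by (simp_all add: heawood_graph_def simple_graph_pg2_incidence_graph
      connected_pg2_incidence_graph girth_pg2_incidence_graph CARD_bit numeral_eq_Suc)

lemma cage_5_6_properties:
  "simple_graph cage_5_6" "connected_graph cage_5_6"
  "card (verts cage_5_6) = 42" "regular cage_5_6 5" "girth cage_5_6 = 6"
  using card_verts_pg2_incidence_graph[where 'a = gf4] regular_pg2_incidence_graph[where 'a = gf4]
  by (simp_all add: cage_5_6_def simple_graph_pg2_incidence_graph
      connected_pg2_incidence_graph girth_pg2_incidence_graph CARD_gf4 numeral_eq_Suc)

lemma max_degree_cage_5_6: "max_degree cage_5_6 = 5"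
proof -
  have "vertex_degree cage_5_6 ` verts cage_5_6 = {5}"
  proof -
    have "verts cage_5_6 \<noteq> {}" using cage_5_6_properties(3) by auto
    then show ?thesis using cage_5_6_properties(4) by (auto simp: regular_def)
  qed
  then show ?thesis by (simp add: max_degree_def)
qed

end

theory Submission
  imports Defs
begin

text \<open>
  The plane of order 4 is cyclic. Multiplication by a primitive element of the field with 64
  elements permutes the 21 points, and the 21 lines, in one cycle each. Numbering points and lines
  along these cycles turns the incidence graph into a graph on two copies of the integers modulo 21:
  point \<open>i\<close> lies on line \<open>l\<close> iff \<open>i - l\<close> belongs to the difference set \<open>{0, 1, 4, 14, 16}\<close>.

  This difference set behaves well modulo 3: three of its elements, \<open>1\<close>, \<open>4\<close> and \<open>16\<close>, are
  congruent to 1, while \<open>0\<close> and \<open>14\<close> represent the other two residues. Color point \<open>i\<close> by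
  \<open>i mod 3\<close> and line \<open>l\<close> by \<open>(l + 1) mod 3\<close>. Then the edges with equally colored ends are
  exactly those of difference 1, 4 or 16. The points of color \<open>j\<close>
  are \<open>3 a + j\<close> and the lines of color \<open>j\<close> are \<open>3 b + j - 1\<close>, so these differences say that \<open>a - b\<close>
  is \<open>0\<close>, \<open>1\<close> or \<open>5\<close> modulo 7. This is a difference set of the Fano plane, so each of the three
  classes spans a Heawood graph. The other edges have differences 0 and 14; following them
  alternately moves the index by multiples of 14 modulo 21, hence the path closes after six edges,
  and there is one such hexagon for each residue modulo 7.

  It remains to color the edges. Those of difference 1, 4 and 16 receive the colors 3, 4 and 5. An
  edge of difference 0 or 14 joins vertices of different colors in \<open>{0, 1, 2}\<close> and receives
  the third one. At a vertex of color \<open>c\<close> the two such edges lead to the two other classes, so each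
  of the six colors occurs exactly once at every vertex, counting the vertex itself.

  The cyclic models of both planes come from \<open>singer_model\<close>, the coloring is checked in
  \<open>semi_total_coloring_singer21\<close>, the two decompositions in \<open>fano_copies\<close> and
  \<open>hexagon_copies\<close>, and \<open>semi_total_coloring_graph_iso\<close> carries everything to the cage.
\<close>

section \<open>Incidence graphs of cyclic difference sets\<close>

text \<open>
  Points are \<open>Inl i\<close> and lines \<open>Inr l\<close>. Adding \<open>N\<close> before subtracting avoids the truncation
  of natural subtraction, so the condition is that \<open>i - l\<close>, read modulo \<open>N\<close>, lies in \<open>D\<close>.
\<close>

definition difference_graph :: "nat \<Rightarrow> nat set \<Rightarrow> (nat + nat) graph" where
  "difference_graph N D = \<lparr>verts = {..<N} <+> {..<N},
     edges = {{Inl i, Inr l} | i l. i < N \<and> l < N \<and> (i + N - l) mod N \<in> D}\<rparr>"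

lemma mod_diff_eq_iff:
  assumes "i < N" "l < N" "d < (N :: nat)"
  shows "(i + N - l) mod N = d \<longleftrightarrow> i = (l + d) mod N"
proof -
  have "(i + N - l) mod N = (if l \<le> i then i - l else i + N - l)"
  proof (cases "l \<le> i")
    case True
    then have "(i + N - l) mod N = (i - l + N) mod N" by simp
    also have "\<dots> = i - l" unfolding mod_add_self2 using assms by simp
    finally show ?thesis using True by simp
  qed (use assms in simp)
  moreover have "(l + d) mod N = (if l + d < N then l + d else l + d - N)"
    using assms by (simp add: le_mod_geq)
  ultimately show ?thesis using assms by (simp only: split: if_split) linarith
qed

text \<open>
  Parametrizing edges by line and difference makes the point a computed quantity. Colors and copies are
  expressed in terms of these two parameters.
\<close>

lemma edges_difference_graph:
  assumes "D \<subseteq> {..<N}"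
  shows "edges (difference_graph N D) = {{Inl ((l + d) mod N), Inr l} | l d. l < N \<and> d \<in> D}"
proof -
  have "i < N \<and> l < N \<and> (i + N - l) mod N \<in> D \<longleftrightarrow> l < N \<and> (\<exists>d\<in>D. i = (l + d) mod N)" for i l
  proof
    assume il: "i < N \<and> l < N \<and> (i + N - l) mod N \<in> D"
    then have "i = (l + (i + N - l) mod N) mod N" by (metis assms lessThan_iff mod_diff_eq_iff subsetD)
    then show "l < N \<and> (\<exists>d\<in>D. i = (l + d) mod N)" using il by blast
  next
    assume "l < N \<and> (\<exists>d\<in>D. i = (l + d) mod N)"
    then obtain d where d: "l < N" "d \<in> D" "i = (l + d) mod N" by blast
    then have "i < N" "d < N" using assms by auto
    then show "i < N \<and> l < N \<and> (i + N - l) mod N \<in> D"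
      using d mod_diff_eq_iff[of i N l d] by simp
  qed
  then have "{{Inl i, Inr l} | i l. i < N \<and> l < N \<and> (i + N - l) mod N \<in> D}
      = {{Inl i, Inr l} | i l. l < N \<and> (\<exists>d\<in>D. i = (l + d) mod N)}"
    by presburger
  also have "\<dots> = {{Inl ((l + d) mod N), Inr l} | l d. l < N \<and> d \<in> D}" by blast
  finally show ?thesis by (simp add: difference_graph_def)
qed

lemma difference_graph_edges_subset:
  "e \<in> edges (difference_graph N D) \<Longrightarrow> e \<subseteq> verts (difference_graph N D)"
  by (auto simp: difference_graph_def)


section \<open>Singer cycles of finite projective planes\<close>

lemma linear_funpow:
  assumes "Vector_Spaces.linear (*s) (*s) (T :: 'a::field ^ 'n \<Rightarrow> 'a ^ 'n)"
  shows "Vector_Spaces.linear (*s) (*s) (T ^^ k)"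
proof (induction k)
  case 0
  then show ?case using vec.linear_id by (simp add: id_def)
next
  case (Suc k)
  then show ?case unfolding funpow.simps by (rule Vector_Spaces.linear_compose[OF _ assms])
qed

lemma pg2_image:
  assumes "Vector_Spaces.linear (*s) (*s) (T :: 'a::field ^ 3 \<Rightarrow> 'a ^ 3)" "inj T"
  shows "P \<in> pg2_points \<Longrightarrow> T ` P \<in> pg2_points" "L \<in> pg2_lines \<Longrightarrow> T ` L \<in> pg2_lines"
  using vec.dim_image_eq[OF assms(1)] vec.linear_subspace_image[OF assms(1)] assms(2)
  by (auto simp: pg2_points_def pg2_lines_def inj_on_subset)

text \<open>
  Let \<open>T\<close> be a collineation for which a point \<open>Q\<close> returns after \<open>N = q\<^sup>2 + q + 1\<close> steps. Applying
  \<open>T\<close> repeatedly to \<open>Q\<close> and to a line \<open>H\<close> gives points \<open>P i\<close> and lines \<open>L l\<close> whose incidence depends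
  only on \<open>i - l\<close>. The hypothesis \<open>sep\<close>, that \<open>D\<close> is not closed under any nonzero shift, forces the
  points to be distinct and the lines to be distinct: a coincidence would close \<open>D\<close> under a shift. As
  there are exactly \<open>N\<close> points and \<open>N\<close> lines, none is missed, so bijectivity comes from counting.
\<close>

lemma singer_model:
  fixes T :: "'a::{field,finite} ^ 3 \<Rightarrow> 'a ^ 3"
  assumes lin: "Vector_Spaces.linear (*s) (*s) T" and inj: "inj T"
    and Q: "Q \<in> pg2_points" and H: "H \<in> pg2_lines"
    and N: "N = CARD('a) ^ 2 + CARD('a) + 1" and period: "(T ^^ N) ` Q = Q"
    and D: "\<And>k. k < N \<Longrightarrow> (T ^^ k) ` Q \<subseteq> H \<longleftrightarrow> k \<in> D"
    and sep: "\<forall>k\<in>{1..<N}. \<exists>d\<in>D. d < N \<and> (d + k) mod N \<notin> D"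
  shows "graph_iso (difference_graph N D) (pg2_incidence_graph :: ('a ^ 3) set graph)"
proof -
  define P where "P i = (T ^^ i) ` Q" for i
  define L where "L i = (T ^^ i) ` H" for i
  have "N > 0" using N by simp
  have injk: "inj (T ^^ k)" for k using inj by (rule inj_fn)
  have add: "(T ^^ i) ` P j = P (i + j)" "(T ^^ i) ` L j = L (i + j)" for i j
    by (simp_all add: P_def L_def image_image funpow_add)
  have Pmult: "P (N * m) = Q" for m
  proof (induction m)
    case 0 then show ?case by (simp add: P_def)
  next
    case (Suc m)
    then show ?case using add(1)[of "N" "N * m"] period by simp
  qed
  have Pmod: "P i = P (i mod N)" for i
    using add(1)[of "i mod N" "N * (i div N)"] Pmult[of "i div N"] by (simp add: P_def)
  have inD: "P i \<subseteq> H \<longleftrightarrow> i mod N \<in> D" for i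
    using D[of "i mod N"] \<open>N > 0\<close> Pmod[of i] by (simp add: P_def)
  have inc: "P i \<subseteq> L l \<longleftrightarrow> (i + N - l) mod N \<in> D" if "l < N" for i l
  proof -
    have "P i = P (i + N)" using Pmod[of i] Pmod[of "i + N"] by simp
    also have "\<dots> = (T ^^ l) ` P (i + N - l)" using that by (simp add: add)
    finally have "P i \<subseteq> L l \<longleftrightarrow> P (i + N - l) \<subseteq> H"
      by (simp add: L_def inj_image_subset_iff[OF injk])
    then show ?thesis by (simp add: inD)
  qed
  have P: "P i \<in> pg2_points" for i
    unfolding P_def by (rule pg2_image(1)[OF linear_funpow[OF lin] injk Q])
  have L: "L i \<in> pg2_lines" for i
    unfolding L_def by (rule pg2_image(2)[OF linear_funpow[OF lin] injk H])
  \<comment> \<open>A point or line that returns after \<open>k\<close> steps would close \<open>D\<close> under the shift by \<open>k\<close>.\<close>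
  have fixP: False if "0 < k" "k < N" "P k = Q" for k
  proof -
    obtain d where d: "d \<in> D" "d < N" "(d + k) mod N \<notin> D" using bspec[OF sep, of k] \<open>0 < k\<close> \<open>k < N\<close> by auto
    have "P (d + k) = P d" using add(1)[of d k] that(3) by (simp add: P_def)
    then show False using d inD[of d] inD[of "d + k"] by simp
  qed
  have fixL: False if "0 < k" "k < N" "L k = H" for k
  proof -
    obtain d where d: "d \<in> D" "d < N" "(d + k) mod N \<notin> D" using bspec[OF sep, of k] \<open>0 < k\<close> \<open>k < N\<close> by auto
    have "P d \<subseteq> H" using d inD[of d] by simp
    then have "(T ^^ k) ` P d \<subseteq> L k" unfolding L_def by (rule image_mono)
    then have "P (d + k) \<subseteq> H" using that(3) by (simp add: add add.commute)
    then show False using d(3) inD by simp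
  qed
  have injP: "inj_on P {..<N}"
  proof (rule linorder_inj_onI)
    fix i j assume ij: "i < j" "i \<in> {..<N}" "j \<in> {..<N}"
    show "P i \<noteq> P j"
    proof
      assume "P i = P j"
      then have "(T ^^ i) ` P 0 = (T ^^ i) ` P (j - i)" using ij by (simp add: add)
      then have "P (j - i) = Q" by (simp add: inj_image_eq_iff[OF injk] P_def)
      then show False using fixP[of "j - i"] ij by (simp add: less_imp_diff_less)
    qed
  qed auto
  have injL: "inj_on L {..<N}"
  proof (rule linorder_inj_onI)
    fix i j assume ij: "i < j" "i \<in> {..<N}" "j \<in> {..<N}"
    show "L i \<noteq> L j"
    proof
      assume "L i = L j"
      then have "(T ^^ i) ` L 0 = (T ^^ i) ` L (j - i)" using ij by (simp add: add)
      then have "L (j - i) = H" by (simp add: inj_image_eq_iff[OF injk] L_def)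
      then show False using fixL[of "j - i"] ij by (simp add: less_imp_diff_less)
    qed
  qed auto
  have surP: "P ` {..<N} = pg2_points"
    by (rule card_subset_eq) (use P injP in \<open>auto simp: card_image card_pg2_points N\<close>)
  have surL: "L ` {..<N} = pg2_lines"
    by (rule card_subset_eq) (use L injL in \<open>auto simp: card_image card_pg2_lines N\<close>)
  define f where "f = case_sum P L"
  have "bij_betw f (verts (difference_graph N D)) (verts (pg2_incidence_graph :: ('a ^ 3) set graph))"
    unfolding bij_betw_def
  proof
    have ne: "P i \<noteq> L l" "L l \<noteq> P i" for i l using P L pg2_points_lines_disjoint by (metis disjoint_iff)+
    show "inj_on f (verts (difference_graph N D))"
      using injP injL ne by (auto simp: inj_on_def f_def difference_graph_def)
    show "f ` verts (difference_graph N D) = verts (pg2_incidence_graph :: ('a ^ 3) set graph)"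
      by (simp add: f_def difference_graph_def pg2_incidence_graph_def Plus_def image_Un image_image
          surP surL)
  qed
  moreover have "edges (pg2_incidence_graph :: ('a ^ 3) set graph) = (`) f ` edges (difference_graph N D)"
  proof -
    have "edges (pg2_incidence_graph :: ('a ^ 3) set graph)
        = {{P i, L l} | i l. i < N \<and> l < N \<and> P i \<subseteq> L l}"
      unfolding pg2_incidence_graph_def surP[symmetric] surL[symmetric] by auto
    also have "\<dots> = {f ` {Inl i, Inr l} | i l. i < N \<and> l < N \<and> (i + N - l) mod N \<in> D}"
      using inc by (simp add: f_def cong: conj_cong)
    also have "\<dots> = (`) f ` {{Inl i, Inr l} | i l. i < N \<and> l < N \<and> (i + N - l) mod N \<in> D}"
      by blast
    finally show ?thesis by (simp add: difference_graph_def)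
  qed
  ultimately show ?thesis unfolding graph_iso_def by blast
qed

text \<open>
  One step of the linear recurrence \<open>s (n + 3) = a s n + b s (n + 1) + c s (n + 2)\<close>, acting on windows
  of three consecutive terms. For an irreducible characteristic polynomial this is multiplication by
  one of its roots, in suitable coordinates.
\<close>

definition shift :: "'a::field \<Rightarrow> 'a \<Rightarrow> 'a \<Rightarrow> 'a ^ 3 \<Rightarrow> 'a ^ 3" where
  "shift a b c v = vector [v $ 2, v $ 3, a * v $ 1 + b * v $ 2 + c * v $ 3]"

text \<open>
  With the hyperplane of vectors with first coordinate zero as the base line, the difference set
  consists of the positions of the zeros of the recurring sequence.
\<close>

lemma singer_model_shift:
  fixes a b c :: "'a::{field,finite}"
  assumes "a \<noteq> 0" and x: "x \<noteq> 0"
    and N: "N = CARD('a) ^ 2 + CARD('a) + 1"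
    and period: "(shift a b c ^^ N) x = r *s x" "r \<noteq> 0"
    and D: "\<And>k. k < N \<Longrightarrow> ((shift a b c ^^ k) x) $ 1 = 0 \<longleftrightarrow> k \<in> D"
    and sep: "\<forall>k\<in>{1..<N}. \<exists>d\<in>D. d < N \<and> (d + k) mod N \<notin> D"
  shows "graph_iso (difference_graph N D) (pg2_incidence_graph :: ('a ^ 3) set graph)"
proof (rule singer_model[where T = "shift a b c" and Q = "vec.span {x}" and H = "{v. v $ 1 = 0}"])
  show lin: "Vector_Spaces.linear (*s) (*s) (shift a b c)"
    by (auto simp: Vector_Spaces.linear_iff shift_def vec_eq_iff forall_3 algebra_simps
        intro: vec.vector_space_axioms)
  show "inj (shift a b c)"
    using \<open>a \<noteq> 0\<close> by (auto simp: inj_def shift_def vec_eq_iff forall_3)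
  show "vec.span {x} \<in> pg2_points" by (rule pg2_point_unique(1)[OF x])
  show "{v :: 'a ^ 3. v $ 1 = 0} \<in> pg2_lines"
  proof -
    define e f :: "'a ^ 3" where "e = vector [0, 0, 1]" and "f = vector [0, 1, 0]"
    have "e \<noteq> 0" by (auto simp: e_def vec_eq_iff forall_3)
    then have e: "vec.span {e} \<in> pg2_points" by (rule pg2_point_unique(1))
    have "f \<notin> vec.span {e}" by (auto simp: e_def f_def vec.span_singleton vec_eq_iff forall_3)
    note line = pg2_line_unique(1)[OF e this]
    have span: "vec.span (insert f (vec.span {e})) = {v. \<exists>k. v - k *s f \<in> vec.span {e}}"
      by (subst vec.span_insert) (simp only: vec.span_span)
    have "v \<in> vec.span (insert f (vec.span {e})) \<longleftrightarrow> v $ 1 = 0" for v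
    proof
      show "v $ 1 = 0" if "v \<in> vec.span (insert f (vec.span {e}))"
        using that unfolding span unfolding vec.span_singleton
        by (auto simp: e_def f_def vec_eq_iff forall_3)
      assume "v $ 1 = 0"
      then have "v - (v $ 2) *s f = (v $ 3) *s e" by (simp add: e_def f_def vec_eq_iff forall_3)
      then show "v \<in> vec.span (insert f (vec.span {e}))"
        unfolding span unfolding vec.span_singleton by blast
    qed
    then have "{v :: 'a ^ 3. v $ 1 = 0} = vec.span (insert f (vec.span {e}))" by blast
    then show ?thesis using line by simp
  qed
  note image = vec.linear_span_image[OF linear_funpow[OF lin], of _ "{x}", symmetric]
  show "(shift a b c ^^ N) ` vec.span {x} = vec.span {x}"
    using vec.span_image_scale[of "{x}" "\<lambda>_. r"] period by (simp add: image)
  show "(shift a b c ^^ k) ` vec.span {x} \<subseteq> {v. v $ 1 = 0} \<longleftrightarrow> k \<in> D" if "k < N" for k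
    unfolding D[OF that, symmetric] image by (force simp: vec.span_singleton intro: exI[of _ 1])
qed (use N sep in auto)

text \<open>
  The sequence over the field with two elements is 0, 0, 1, 1, 1, 0, 1, of period 7.
\<close>

lemma heawood_singer: "graph_iso (difference_graph 7 {0, 1, 5}) heawood_graph"
  unfolding heawood_graph_def
proof (rule singer_model_shift[where a = 1 and b = 0 and c = 1 and r = 1 and x = "vector [0, 0, 1]"])
  show "((shift 1 0 1 ^^ k) (vector [0, 0, 1 :: bit])) $ 1 = 0 \<longleftrightarrow> k \<in> {0, 1, 5}" if "k < 7" for k :: nat
  proof -
    have "k \<in> set [0..<7]" using that by simp
    then show ?thesis by (auto simp: upt_rec numeral_eq_Suc shift_def)
  qed
  show "\<forall>k\<in>{1..<7}. \<exists>d\<in>{0, 1, 5}. d < 7 \<and> (d + k) mod 7 \<notin> {0, 1, 5 :: nat}"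
    by code_simp
  show "vector [0, 0, 1] \<noteq> (0 :: bit ^ 3)" by (simp add: vec_eq_iff forall_3)
  show "(shift 1 0 1 ^^ 7) (vector [0, 0, 1]) = 1 *s (vector [0, 0, 1 :: bit])"
    by (simp add: shift_def numeral_eq_Suc)
qed (simp_all add: CARD_bit)

text \<open>
  For the primitive polynomial \<open>x\<^sup>3 = x\<^sup>2 + x + w\<close> over the field with four elements a root satisfies
  \<open>\<theta>\<^sup>2\<^sup>1 = w\<close>, which is the scalar by which the sequence is multiplied after 21 steps.
\<close>

lemma cage_singer: "graph_iso (difference_graph 21 {0, 1, 4, 14, 16}) cage_5_6"
  unfolding cage_5_6_def
proof (rule singer_model_shift[where a = "GF4 0 1" and b = 1 and c = 1 and r = "GF4 0 1" and x = "vector [0, 0, 1]"])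
  show "((shift (GF4 0 1) 1 1 ^^ k) (vector [0, 0, 1])) $ 1 = 0 \<longleftrightarrow> k \<in> {0, 1, 4, 14, 16}" if "k < 21" for k :: nat
  proof -
    have "k \<in> set [0..<21]" using that by simp
    then show ?thesis by (auto simp: upt_rec numeral_eq_Suc shift_def zero_gf4_def one_gf4_def)
  qed
  show "\<forall>k\<in>{1..<21}. \<exists>d\<in>{0, 1, 4, 14, 16}. d < 21 \<and> (d + k) mod 21 \<notin> {0, 1, 4, 14, 16 :: nat}"
    by code_simp
  show "vector [0, 0, 1] \<noteq> (0 :: gf4 ^ 3)" by (simp add: vec_eq_iff forall_3)
  show "(shift (GF4 0 1) 1 1 ^^ 21) (vector [0, 0, 1]) = GF4 0 1 *s (vector [0, 0, 1])"
    by (simp add: shift_def numeral_eq_Suc vec_eq_iff forall_3 zero_gf4_def one_gf4_def)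
qed (simp_all add: CARD_gf4 zero_gf4_def)


section \<open>Edge partitions into embedded copies\<close>

text \<open>
  A decomposition given by explicit embeddings \<open>h i\<close> of one fixed graph. Unlike the mere existence of
  isomorphic pieces, it can be composed with an injection of the ambient graph. Injectivity of the
  uncurried map says at once that each \<open>h i\<close> is injective and that the images are disjoint; the first
  conjunct excludes isolated vertices, which a set of edges cannot record.
\<close>

definition edge_partition_by_copies ::
    "nat \<Rightarrow> 'b graph \<Rightarrow> (nat \<Rightarrow> 'b \<Rightarrow> 'a) \<Rightarrow> 'a set set \<Rightarrow> bool" where
  "edge_partition_by_copies n H h F \<longleftrightarrow> \<Union>(edges H) = verts H \<and>
     inj_on (\<lambda>(i, v). h i v) ({..<n} \<times> verts H) \<and> F = (\<Union>i<n. (`) (h i) ` edges H)"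

lemma edge_partition_by_copies_comp:
  assumes h: "edge_partition_by_copies n H h F" and f: "inj_on f (\<Union>F)"
  shows "edge_partition_by_copies n H (\<lambda>i. f \<circ> h i) ((`) f ` F)"
proof -
  have verts: "\<Union>(edges H) = verts H" and F: "F = (\<Union>i<n. (`) (h i) ` edges H)"
    and inj: "inj_on (\<lambda>(i, v). h i v) ({..<n} \<times> verts H)"
    using h by (simp_all add: edge_partition_by_copies_def)
  have "(\<lambda>(i, v). h i v) ` ({..<n} \<times> verts H) \<subseteq> \<Union>F" by (auto simp: F simp flip: verts)
  with f have "inj_on f ((\<lambda>(i, v). h i v) ` ({..<n} \<times> verts H))" by (rule inj_on_subset)
  with inj have "inj_on (f \<circ> (\<lambda>(i, v). h i v)) ({..<n} \<times> verts H)" by (rule comp_inj_on)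
  moreover have "f \<circ> (\<lambda>(i, v). h i v) = (\<lambda>(i, v). (f \<circ> h i) v)" by auto
  moreover have "(`) f ` F = (\<Union>i<n. (`) (f \<circ> h i) ` edges H)"
    by (simp add: F image_UN image_image image_comp)
  ultimately show ?thesis using verts by (simp add: edge_partition_by_copies_def)
qed

lemma graph_iso_trans:
  assumes "graph_iso G H" "graph_iso H K"
  shows "graph_iso G K"
proof -
  obtain f g where f: "bij_betw f (verts G) (verts H)" "edges H = (`) f ` edges G"
    and g: "bij_betw g (verts H) (verts K)" "edges K = (`) g ` edges H"
    using assms unfolding graph_iso_def by metis
  have "edges K = (`) (g \<circ> f) ` edges G"
    unfolding f(2) g(2) by (simp only: image_image o_def)
  with bij_betw_trans[OF f(1) g(1)] show ?thesis unfolding graph_iso_def by blast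
qed

lemma disjoint_copies_if_edge_partition:
  assumes h: "edge_partition_by_copies n H h F" and iso: "graph_iso H H'"
  shows "disjoint_copies n H' (edge_induced F)"
proof -
  define K where "K i = \<lparr>verts = h i ` verts H, edges = (`) (h i) ` edges H\<rparr>" for i
  have verts: "verts H = \<Union>(edges H)" and F: "F = (\<Union>i<n. (`) (h i) ` edges H)"
    and inj: "inj_on (\<lambda>(i, v). h i v) ({..<n} \<times> verts H)"
    using h by (auto simp: edge_partition_by_copies_def)
  have "graph_iso (K i) H" if "i < n" for i
  proof -
    have inj_i: "inj_on (h i) (verts H)" using inj that by (auto simp: inj_on_def)
    let ?g = "inv_into (verts H) (h i)"
    have "?g ` h i ` e = e" if "e \<in> edges H" for e
      using that verts by (intro inv_into_image_cancel[OF inj_i]) auto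
    then have "edges H = (`) ?g ` edges (K i)" by (simp add: K_def image_image)
    moreover have "bij_betw ?g (verts (K i)) (verts H)"
      using inj_on_imp_bij_betw[OF inj_i] by (simp add: K_def bij_betw_inv_into)
    ultimately show ?thesis unfolding graph_iso_def by blast
  qed
  moreover have "disjoint_family_on (\<lambda>i. verts (K i)) {..<n}"
    using inj by (fastforce simp: disjoint_family_on_def K_def inj_on_def)
  moreover have "\<Union>F = (\<Union>i<n. verts (K i))" by (auto simp: F K_def verts)
  moreover have "F = (\<Union>i<n. edges (K i))" by (simp add: F K_def)
  ultimately show ?thesis unfolding disjoint_copies_def
    by (intro exI[of _ K]) (auto simp: edge_induced_def intro: graph_iso_trans[OF _ iso])
qed


section \<open>Semi-total colorings under isomorphism\<close>

lemma max_degree_graph_iso: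
  assumes wf: "\<forall>e\<in>edges G. e \<subseteq> verts G" and f: "bij_betw f (verts G) (verts H)"
    and eH: "edges H = (`) f ` edges G"
  shows "max_degree H = max_degree G"
proof -
  have inj: "inj_on f (verts G)" using f by (rule bij_betw_imp_inj_on)
  have "vertex_degree H (f v) = vertex_degree G v" if v: "v \<in> verts G" for v
  proof -
    have "{e \<in> edges H. f v \<in> e} = (`) f ` {e \<in> edges G. v \<in> e}"
      using v wf inj by (auto simp: eH dest: inj_onD)
    moreover have "inj_on ((`) f) {e \<in> edges G. v \<in> e}"
      by (rule inj_on_subset[OF inj_on_image_Pow[OF inj]]) (use wf in auto)
    ultimately show ?thesis by (simp add: vertex_degree_def card_image)
  qed
  then have "vertex_degree H ` verts H = vertex_degree G ` verts G"
    unfolding bij_betw_imp_surj_on[OF f, symmetric] by (simp add: image_image)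
  then show ?thesis by (simp add: max_degree_def)
qed

text \<open>
  Pulling colors back along the inverse of \<open>f\<close> changes neither incidences nor the number of available
  colors, which is determined by the maximum degree.
\<close>

lemma semi_total_coloring_graph_iso:
  assumes wf: "\<forall>e\<in>edges G. e \<subseteq> verts G" and f: "bij_betw f (verts G) (verts H)"
    and eH: "edges H = (`) f ` edges G" and \<mu>: "semi_total_coloring G \<mu>"
  obtains \<nu> where "semi_total_coloring H \<nu>"
    and "equal_end_edges H \<nu> = (`) f ` equal_end_edges G \<mu>"
proof -
  have inj: "inj_on f (verts G)" using f by (rule bij_betw_imp_inj_on)
  define g where "g = inv_into (verts G) f"
  define \<nu> where "\<nu> = \<mu> \<circ> map_sum g ((`) g)"
  have \<nu>v: "\<nu> (Inl (f v)) = \<mu> (Inl v)" if "v \<in> verts G" for v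
    using that inj by (simp add: \<nu>_def g_def)
  have \<nu>e: "\<nu> (Inr (f ` e)) = \<mu> (Inr e)" if "e \<in> edges G" for e
    using that wf inj by (simp add: \<nu>_def g_def inv_into_image_cancel)
  have vH: "verts H = f ` verts G" using f by (simp add: bij_betw_imp_surj_on)
  have int: "f ` e \<inter> f ` e' = f ` (e \<inter> e')" if "e \<in> edges G" "e' \<in> edges G" for e e'
    using inj_on_image_Int[OF inj, of e e'] that wf by auto
  have mem: "f v \<in> f ` e \<longleftrightarrow> v \<in> e" if "v \<in> verts G" "e \<in> edges G" for v e
    using inj_on_image_mem_iff[OF inj, of v e] that wf by auto
  have "semi_total_coloring H \<nu>"
    unfolding semi_total_coloring_def max_degree_graph_iso[OF wf f eH]
  proof (intro conjI ballI impI)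
    have "\<mu> (Inl v) < max_degree G + 1" if "v \<in> verts G" for v
      using \<mu> that by (auto simp: semi_total_coloring_def)
    moreover have "\<mu> (Inr e) < max_degree G + 1" if "e \<in> edges G" for e
      using \<mu> that by (auto simp: semi_total_coloring_def)
    ultimately show "\<nu> \<in> (verts H <+> edges H) \<rightarrow> {..<max_degree G + 1}"
      unfolding vH eH by (auto simp: \<nu>v \<nu>e)
  next
    fix x y assume "x \<in> edges H" "y \<in> edges H" "x \<noteq> y \<and> x \<inter> y \<noteq> {}"
    moreover from this obtain e e' where "e \<in> edges G" "x = f ` e" "e' \<in> edges G" "y = f ` e'"
      by (auto simp: eH)
    ultimately have e: "e \<in> edges G" "x = f ` e" "e' \<in> edges G" "y = f ` e'" "e \<noteq> e'" "e \<inter> e' \<noteq> {}"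
      by (auto simp: int)
    then have "\<mu> (Inr e) \<noteq> \<mu> (Inr e')" using \<mu> by (simp add: semi_total_coloring_def)
    then show "\<nu> (Inr x) \<noteq> \<nu> (Inr y)" using e by (simp add: \<nu>e)
  next
    fix x y assume "x \<in> verts H" "y \<in> edges H" "x \<in> y"
    then obtain v e where e: "x = f v" "e \<in> edges G" "y = f ` e" "v \<in> e"
      unfolding eH by blast
    moreover from this have "v \<in> verts G" using wf by blast
    ultimately have "\<mu> (Inl v) \<noteq> \<mu> (Inr e)" using \<mu> by (simp add: semi_total_coloring_def)
    then show "\<nu> (Inl x) \<noteq> \<nu> (Inr y)" using e \<open>v \<in> verts G\<close> by (simp add: \<nu>v \<nu>e)
  qed
  moreover have "equal_end_edges H \<nu> = (`) f ` equal_end_edges G \<mu>"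
  proof -
    have "(\<forall>u\<in>f ` e. \<forall>v\<in>f ` e. \<nu> (Inl u) = \<nu> (Inl v)) \<longleftrightarrow> (\<forall>u\<in>e. \<forall>v\<in>e. \<mu> (Inl u) = \<mu> (Inl v))"
      if "e \<in> edges G" for e
      using wf that by (simp add: \<nu>v subset_iff)
    then show ?thesis unfolding equal_end_edges_def eH by blast
  qed
  ultimately show thesis by (rule that)
qed


section \<open>The coloring of the cyclic model\<close>

abbreviation singer21 :: "(nat + nat) graph" where
  "singer21 \<equiv> difference_graph 21 {0, 1, 4, 14, 16}"

text \<open>
  The color of the edge of difference \<open>d\<close> at line \<open>l\<close>. Line \<open>l\<close> has color \<open>l + 1\<close> modulo 3; its point
  has color \<open>l\<close> if \<open>d = 0\<close> and \<open>l + 14\<close>, that is \<open>l + 2\<close>, if \<open>d = 14\<close>. The first two values are the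
  residues left over in these two cases.
\<close>

definition difference_color :: "nat \<Rightarrow> nat \<Rightarrow> nat" where
  "difference_color l d =
     (if d = 0 then (l + 2) mod 3 else if d = 14 then l mod 3
      else if d = 1 then 3 else if d = 4 then 4 else 5)"

text \<open>
  The indices of the point and of the line of an edge are recovered as the unique elements of the
  preimages under the two injections.
\<close>

definition singer_coloring :: "(nat + nat) + (nat + nat) set \<Rightarrow> nat" where
  "singer_coloring = case_sum (case_sum (\<lambda>i. i mod 3) (\<lambda>l. (l + 1) mod 3))
     (\<lambda>e. let i = the_elem (Inl -` e); l = the_elem (Inr -` e)
          in difference_color l ((i + 21 - l) mod 21))"

lemma singer_coloring_simps:
  "singer_coloring (Inl (Inl i)) = i mod 3"
  "singer_coloring (Inl (Inr l)) = (l + 1) mod 3"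
  by (simp_all add: singer_coloring_def)

lemma singer_coloring_edge:
  assumes "l < 21" "d < 21"
  shows "singer_coloring (Inr {Inl ((l + d) mod 21), Inr l}) = difference_color l d"
proof -
  have "Inl -` {Inl ((l + d) mod 21), Inr l} = {(l + d) mod 21}"
    "Inr -` {Inl ((l + d) mod 21), Inr l} = {l}" by auto
  moreover have "((l + d) mod 21 + 21 - l) mod 21 = d"
    using assms mod_diff_eq_iff[of "(l + d) mod 21" 21 l d] by simp
  ultimately show ?thesis by (simp add: singer_coloring_def Let_def)
qed

lemma singer21_edgeE:
  assumes "e \<in> edges singer21"
  obtains l d where "e = {Inl ((l + d) mod 21), Inr l}" "l < 21" "d \<in> {0, 1, 4, 14, 16}"
    "singer_coloring (Inr e) = difference_color l d"
proof -
  from assms obtain l d where e: "e = {Inl ((l + d) mod 21), Inr l}" "l < 21" "d \<in> {0, 1, 4, 14, 16}"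
    by (auto simp: edges_difference_graph)
  then show thesis using that[OF e] singer_coloring_edge[of l d] by auto
qed

lemma mod_21_mod_3: "(k :: nat) mod 21 mod 3 = k mod 3"
  by (simp add: mod_mod_cancel)

lemma difference_color_line:
  assumes "d \<in> {0, 1, 4, 14, 16}" "d' \<in> {0, 1, 4, 14, 16}" "d \<noteq> d'"
  shows "difference_color l d \<noteq> difference_color l d'"
proof -
  have "(l + 2) mod 3 \<noteq> l mod 3" by presburger
  moreover have "(l + 2) mod 3 < 3" "l mod 3 < 3" by simp_all
  ultimately show ?thesis using assms by (auto simp: difference_color_def simp del: mod_less_divisor)
qed

text \<open>
  At a point the two differences belong to different lines. The one case with content is an edge of
  difference 0 meeting one of difference 14: then \<open>l\<close> is \<open>l' + 14\<close> modulo 21, hence \<open>l' + 2\<close> modulo 3,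
  and the colors \<open>l + 2\<close> and \<open>l'\<close> differ by 1.
\<close>

lemma difference_color_point:
  assumes "d \<in> {0, 1, 4, 14, 16}" "d' \<in> {0, 1, 4, 14, 16}" "d \<noteq> d'"
    and "(l + d) mod 21 = (l' + d') mod 21"
  shows "difference_color l d \<noteq> difference_color l' d'"
proof -
  have step: "(k + 2) mod 3 \<noteq> m mod 3" if "k mod 21 = (m + 14) mod 21" for k m :: nat
  proof -
    have "k mod 3 = (m + 14) mod 3" using arg_cong[OF that, of "\<lambda>n. n mod 3"] by (simp only: mod_21_mod_3)
    then have "(k + 2) mod 3 = (m + 14 + 2) mod 3" by (rule mod_add_cong) (rule refl)
    also have "\<dots> \<noteq> m mod 3" by presburger
    finally show ?thesis .
  qed
  have cross: "(l + 2) mod 3 \<noteq> l' mod 3" if "d = 0" "d' = 14"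
    using assms(4) unfolding that add_0_right by (rule step)
  have cross': "(l' + 2) mod 3 \<noteq> l mod 3" if "d = 14" "d' = 0"
    using assms(4)[symmetric] unfolding that add_0_right by (rule step)
  \<comment> \<open>Naming the residues keeps them opaque, so that only the bounds and the two disequalities matter.\<close>
  define p q p' q' where pq: "p = (l + 2) mod 3" "q = l mod 3" "p' = (l' + 2) mod 3" "q' = l' mod 3"
  have "p < 3" "q < 3" "p' < 3" "q' < 3" unfolding pq by simp_all
  with cross cross' show ?thesis
    unfolding difference_color_def pq[symmetric] using assms(1-3) by auto
qed

lemma difference_color_vertex:
  assumes "d \<in> {0, 1, 4, 14, 16}"
  shows "difference_color l d \<noteq> (l + 1) mod 3" "difference_color l d \<noteq> (l + d) mod 21 mod 3"
    "difference_color l d < 6"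
proof -
  show "difference_color l d \<noteq> (l + 1) mod 3"
    using assms mod_less_divisor[of 3 "l + 1"] by (elim insertE emptyE; simp add: difference_color_def; presburger)
  show "difference_color l d \<noteq> (l + d) mod 21 mod 3"
    unfolding mod_21_mod_3
    using assms mod_less_divisor[of 3 "l + d"] by (elim insertE emptyE; simp add: difference_color_def; presburger)
  show "difference_color l d < 6"
    unfolding difference_color_def using mod_less_divisor[of 3 l] mod_less_divisor[of 3 "l + 2"]
    by (simp del: mod_less_divisor)
qed

lemma semi_total_coloring_singer21:
  assumes "max_degree singer21 = 5"
  shows "semi_total_coloring singer21 singer_coloring"
  unfolding semi_total_coloring_def assms
proof (intro conjI ballI impI)
  have "singer_coloring (Inl v) < 6" for v
    by (cases v) (simp_all add: singer_coloring_simps less_trans[OF mod_less_divisor])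
  moreover have "singer_coloring (Inr e) < 6" if "e \<in> edges singer21" for e
    using that by (elim singer21_edgeE) (simp add: difference_color_vertex)
  ultimately show "singer_coloring \<in> (verts singer21 <+> edges singer21) \<rightarrow> {..<5 + 1}"
    by auto
next
  fix e f assume "e \<in> edges singer21" "f \<in> edges singer21" and ef: "e \<noteq> f \<and> e \<inter> f \<noteq> {}"
  then obtain l d l' d' where
    e: "e = {Inl ((l + d) mod 21), Inr l}" "d \<in> {0, 1, 4, 14, 16}"
      "singer_coloring (Inr e) = difference_color l d" "l < 21" and
    f: "f = {Inl ((l' + d') mod 21), Inr l'}" "d' \<in> {0, 1, 4, 14, 16}"
      "singer_coloring (Inr f) = difference_color l' d'" "l' < 21"
    by (metis singer21_edgeE)
  from ef have "l = l' \<and> d \<noteq> d' \<or> l \<noteq> l' \<and> (l + d) mod 21 = (l' + d') mod 21"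
    unfolding e(1) f(1) by (cases "l = l'") auto
  then consider "l = l'" "d \<noteq> d'" | "l \<noteq> l'" "(l + d) mod 21 = (l' + d') mod 21"
    by blast
  then show "singer_coloring (Inr e) \<noteq> singer_coloring (Inr f)"
  proof cases
    case 1
    then show ?thesis using e f difference_color_line by simp
  next
    case 2
    have "d \<noteq> d'"
    proof
      assume "d = d'"
      \<comment> \<open>Adding the complement \<open>21 - d\<close> cancels \<open>d\<close> and so recovers the line from the point.\<close>
      have undo: "((k + d) mod 21 + (21 - d)) mod 21 = k" if "k < 21" for k
        unfolding mod_add_left_eq using e(2) that by auto
      show False using undo[OF e(4)] undo[OF f(4)] 2 \<open>d = d'\<close> by simp
    qed
    then show ?thesis using 2 e f difference_color_point by simp
  qed
next
  fix v e assume "v \<in> verts singer21" "e \<in> edges singer21" "v \<in> e"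
  obtain l d where e: "e = {Inl ((l + d) mod 21), Inr l}" "l < 21" "d \<in> {0, 1, 4, 14, 16}"
    "singer_coloring (Inr e) = difference_color l d"
    using \<open>e \<in> edges singer21\<close> by (rule singer21_edgeE)
  have "v = Inl ((l + d) mod 21) \<or> v = Inr l" using \<open>v \<in> e\<close> e(1) by blast
  then show "singer_coloring (Inl v) \<noteq> singer_coloring (Inr e)"
    using difference_color_vertex(1,2)[OF e(3), of l] by (metis e(4) singer_coloring_simps)
qed

text \<open>
  The ends have the colors \<open>l + d\<close> and \<open>l + 1\<close> modulo 3, so they agree iff \<open>d\<close> is congruent to 1.
\<close>

lemma equal_end_edges_singer21:
  "equal_end_edges singer21 singer_coloring
     = {{Inl ((l + d) mod 21), Inr l} | l d. l < 21 \<and> d \<in> {1, 4, 16}}" (is ?equal)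
  "edges singer21 - equal_end_edges singer21 singer_coloring
     = {{Inl ((l + d) mod 21), Inr l} | l d. l < 21 \<and> d \<in> {0, 14}}" (is ?unequal)
proof -
  let ?E = "\<lambda>l d :: nat. {Inl ((l + d) mod 21), Inr l :: nat + nat}"
  let ?D = "{0, 1, 4, 14, 16 :: nat}"
  let ?same = "\<lambda>e. \<forall>u\<in>e. \<forall>v\<in>e. singer_coloring (Inl u) = singer_coloring (Inl v)"
  have same: "?same (?E l d) \<longleftrightarrow> d \<in> {1, 4, 16}" if "d \<in> ?D" for l d
  proof -
    have "?same (?E l d) \<longleftrightarrow> (l + d) mod 3 = (l + 1) mod 3"
      by (auto simp only: singer_coloring_simps mod_21_mod_3 ball_simps)
    also have "\<dots> \<longleftrightarrow> d \<in> {1, 4, 16}"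
      using that by (elim insertE emptyE; simp; presburger)
    finally show ?thesis .
  qed
  have edges: "edges singer21 = {?E l d | l d. l < 21 \<and> d \<in> ?D}"
    by (rule edges_difference_graph) simp
  have "equal_end_edges singer21 singer_coloring = {?E l d | l d. l < 21 \<and> d \<in> ?D \<and> ?same (?E l d)}"
    unfolding equal_end_edges_def edges by blast
  also have "\<dots> = {?E l d | l d. l < 21 \<and> d \<in> ?D \<and> d \<in> {1, 4, 16}}"
    by (intro Collect_cong ex_cong1 conj_cong refl same)
  finally show ?equal by blast
  have "edges singer21 - equal_end_edges singer21 singer_coloring
      = {?E l d | l d. l < 21 \<and> d \<in> ?D \<and> \<not> ?same (?E l d)}"
    unfolding equal_end_edges_def edges by blast
  also have "\<dots> = {?E l d | l d. l < 21 \<and> d \<in> ?D \<and> d \<notin> {1, 4, 16}}"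
    by (intro Collect_cong ex_cong1 conj_cong refl arg_cong[where f = Not] same)
  also have "\<dots> = {?E l d | l d. l < 21 \<and> d \<in> {0, 14}}"
    by (intro Collect_cong ex_cong1 conj_cong refl) auto
  finally show ?unequal .
qed


section \<open>Three Heawood graphs and seven hexagons\<close>

text \<open>
  The vertices of color \<open>j\<close> are the points \<open>3 a + j\<close> and the lines \<open>3 b + j - 1\<close>; the summand 20 stands
  for \<open>-1\<close> modulo 21. A difference \<open>d\<close> modulo 7 becomes \<open>3 d + 1\<close> modulo 21, which sends
  \<open>{0, 1, 5}\<close> to \<open>{1, 4, 16}\<close>.
\<close>

definition fano_embedding :: "nat \<Rightarrow> nat + nat \<Rightarrow> nat + nat" where
  "fano_embedding j = map_sum (\<lambda>a. 3 * a + j) (\<lambda>b. (3 * b + j + 20) mod 21)"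

lemma fano_copies:
  "edge_partition_by_copies 3 (difference_graph 7 {0, 1, 5}) fano_embedding
     {{Inl ((l + d) mod 21), Inr l} | l d. l < 21 \<and> d \<in> {1, 4, 16}}" (is "edge_partition_by_copies 3 ?H _ ?F")
proof -
  have edges: "edges ?H = {{Inl ((b + d) mod 7), Inr b} | b d. b < 7 \<and> d \<in> {0, 1, 5}}"
    by (simp add: edges_difference_graph)
  have "\<Union>(edges ?H) = verts ?H"
  proof
    show "verts ?H \<subseteq> \<Union>(edges ?H)"
    proof
      fix v assume "v \<in> verts ?H"
      then obtain b where "b < 7" "v = Inl ((b + 0) mod 7) \<or> v = Inr b" by (auto simp: difference_graph_def)
      then show "v \<in> \<Union>(edges ?H)" unfolding edges by blast
    qed
  qed (use difference_graph_edges_subset in blast)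
  moreover have "inj_on (\<lambda>(j, v). fano_embedding j v) ({..<3} \<times> verts ?H)"
  proof -
    have 1: "j = j' \<and> a = a'" if "3 * a + j = 3 * a' + j'" "j < 3" "j' < 3" for a a' j j' :: nat
      using that by presburger
    have 2: "j = j' \<and> b = b'" if "(3 * b + j + 20) mod 21 = (3 * b' + j' + 20) mod 21" "j < 3" "j' < 3" "b < 7" "b' < 7"
      for b b' j j' :: nat
    proof -
      \<comment> \<open>Adding 20 subtracts 1 modulo 21, so adding 1 undoes it.\<close>
      have pred: "((x + 20) mod 21 + 1) mod 21 = x" if "x < 21" for x :: nat
        unfolding mod_add_left_eq using that by simp
      have "3 * b + j < 21" "3 * b' + j' < 21" using that by simp_all
      then have "3 * b + j = 3 * b' + j'"
        using pred[of "3 * b + j"] pred[of "3 * b' + j'"] unfolding that(1) by simp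
      then show ?thesis using 1 that by blast
    qed
    show ?thesis
      by (auto simp: inj_on_def fano_embedding_def difference_graph_def dest: 1 2)
  qed
  moreover have "?F = (\<Union>j<3. (`) (fano_embedding j) ` edges ?H)"
  proof -
    have image: "fano_embedding j ` {Inl ((b + d) mod 7), Inr b}
        = {Inl (((3 * b + j + 20) mod 21 + (3 * d + 1)) mod 21), Inr ((3 * b + j + 20) mod 21)}"
      if "j < 3" for j b d
    proof -
      have "3 * ((b + d) mod 7) + j = ((3 * b + j + 20) mod 21 + (3 * d + 1)) mod 21"
      proof -
        have "((3 * b + j + 20) mod 21 + (3 * d + 1)) mod 21 = (3 * (b + d) + j + 21) mod 21"
          unfolding mod_add_left_eq by (simp add: algebra_simps)
        also have "\<dots> = (3 * (b + d) mod 21 + j) mod 21" unfolding mod_add_self2 mod_add_left_eq ..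
        also have "3 * (b + d) mod 21 = 3 * ((b + d) mod 7)" by (simp add: mult_mod_right)
        also have "\<dots> + j < 21" using that mod_less_divisor[of 7 "b + d"] by linarith
        then have "(3 * ((b + d) mod 7) + j) mod 21 = 3 * ((b + d) mod 7) + j" by (rule mod_less)
        finally show ?thesis ..
      qed
      then show ?thesis by (simp add: fano_embedding_def)
    qed
    have line: "\<exists>j<3. \<exists>b<7. l = (3 * b + j + 20) mod 21" if "l < 21" for l :: nat
    proof -
      \<comment> \<open>Base 3 digits of the successor of \<open>l\<close>, because the embedding shifts lines back by one.\<close>
      define x where "x = (l + 1) mod 21"
      have "l = (x + 20) mod 21" using that by (simp add: x_def mod_add_left_eq)
      then have "l = (3 * (x div 3) + x mod 3 + 20) mod 21" by simp
      moreover have "x div 3 < 7" by (simp add: x_def less_mult_imp_div_less)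
      ultimately show ?thesis by (intro exI[of _ "x mod 3"] exI[of _ "x div 3"] conjI) simp_all
    qed
    show ?thesis
    proof (intro set_eqI iffI)
      fix e assume "e \<in> ?F"
      then obtain l d' where "e = {Inl ((l + d') mod 21), Inr l}" "l < 21" "d' \<in> {1, 4, 16}" by blast
      moreover from this obtain d where "d' = 3 * d + 1" "d \<in> {0, 1, 5 :: nat}"
        using that[of 0] that[of 1] that[of 5] by auto
      ultimately have e: "e = {Inl ((l + (3 * d + 1)) mod 21), Inr l}" "l < 21" "d \<in> {0, 1, 5}"
        by simp_all
      obtain j b where "j < 3" "b < 7" and l: "l = (3 * b + j + 20) mod 21" using line e(2) by blast
      have "e = fano_embedding j ` {Inl ((b + d) mod 7), Inr b}"
        using e(1) unfolding image[OF \<open>j < 3\<close>] l .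
      then show "e \<in> (\<Union>j<3. (`) (fano_embedding j) ` edges ?H)"
        unfolding edges using \<open>j < 3\<close> \<open>b < 7\<close> e(3) by blast
    next
      fix e assume "e \<in> (\<Union>j<3. (`) (fano_embedding j) ` edges ?H)"
      then obtain j e' where "j < 3" "e' \<in> edges ?H" "e = fano_embedding j ` e'" by blast
      moreover from this obtain b d where "e' = {Inl ((b + d) mod 7), Inr b}" "d \<in> {0, 1, 5}"
        unfolding edges by blast
      moreover from this have "3 * d + 1 \<in> {1, 4, 16}" by auto
      moreover have "(3 * b + j + 20) mod 21 < 21" by simp
      ultimately show "e \<in> ?F" using image[OF \<open>j < 3\<close>] by blast
    qed
  qed
  ultimately show ?thesis by (simp add: edge_partition_by_copies_def)
qed

text \<open>
  Starting at point \<open>c\<close>, an edge of difference 0 leads to line \<open>c\<close>, and one of difference 14 to point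
  \<open>c + 14\<close>; every two steps add 14 to the index, and three times 14 vanishes modulo 21.
\<close>

definition hexagon_embedding :: "nat \<Rightarrow> nat \<Rightarrow> nat + nat" where
  "hexagon_embedding c k =
     (if even k then Inl ((c + 7 * k) mod 21) else Inr ((c + 7 * (k - 1)) mod 21))"

lemma hexagon_copies:
  "edge_partition_by_copies 7 (cycle_graph 6) hexagon_embedding
     {{Inl ((l + d) mod 21), Inr l} | l d. l < 21 \<and> d \<in> {0, 14}}" (is "edge_partition_by_copies 7 ?H _ ?F")
proof -
  have lt6: "k < 6 \<longleftrightarrow> k \<in> {0, 1, 2, 3, 4, 5}" for k :: nat by auto
  have edges: "edges ?H = {{0, 1}, {2, 1}, {2, 3}, {4, 3}, {4, 5}, {0, 5}}"
  proof -
    have "edges ?H = (\<lambda>i. {i, Suc i mod 6}) ` {..<6}" by (auto simp: cycle_graph_def)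
    also have "{..<6} = {0, 1, 2, 3, 4, 5 :: nat}" using lt6 by blast
    moreover have "Suc 0 mod 6 = 1" "Suc 1 mod 6 = 2" "Suc 2 mod 6 = 3" "Suc 3 mod 6 = 4" "Suc 4 mod 6 = 5"
      "Suc 5 mod 6 = 0" by simp_all
    ultimately show ?thesis
      by (simp only: image_insert image_empty insert_commute[of 1 2 "{}"] insert_commute[of 3 4 "{}"]
          insert_commute[of 5 0 "{}"])
  qed
  have "\<Union>(edges ?H) = verts ?H" unfolding edges by (auto simp: cycle_graph_def)
  moreover have "inj_on (\<lambda>(c, k). hexagon_embedding c k) ({..<7} \<times> verts ?H)"
  proof -
    have "c = c' \<and> k = k'"
      if "hexagon_embedding c k = hexagon_embedding c' k'" "c < 7" "c' < 7" "k < 6" "k' < 6" for c c' k k'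
    proof -
      have mod_7: "m mod 21 mod 7 = m mod 7" for m :: nat by (simp add: mod_mod_cancel)
      \<comment> \<open>Every vertex of the hexagon \<open>c\<close> has an index congruent to \<open>c\<close> modulo 7.\<close>
      have residue: "case_sum (\<lambda>i. i mod 7) (\<lambda>l. l mod 7) (hexagon_embedding c k) = c mod 7" for c k
        by (simp add: hexagon_embedding_def mod_7)
      have "c = c'" using residue[of c k] residue[of c' k'] that(1-3) by simp
      moreover have "(c + 28) mod 21 = c + 7" using \<open>c < 7\<close> by (simp add: mod_if)
      ultimately show ?thesis
        using that(1,2) that(4,5)[unfolded lt6] by (auto simp: hexagon_embedding_def)
    qed
    then show ?thesis unfolding inj_on_def cycle_graph_def
      by (simp only: split_paired_Ball_Sigma split_conv prod.inject graph.simps lessThan_iff) blast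
  qed
  moreover have "?F = (\<Union>c<7. (`) (hexagon_embedding c) ` edges ?H)"
  proof -
    have image: "(`) (hexagon_embedding c) ` edges ?H
        = (\<Union>m\<in>{0, 7, 14}. \<Union>d\<in>{0, 14}. {{Inl (((c + m) mod 21 + d) mod 21), Inr ((c + m) mod 21)}})" for c
    proof -
      have wrap: "(c + 28) mod 21 = (c + 7) mod 21" using mod_add_self2[of "c + 7" 21] by (simp add: add.commute)
      have h: "hexagon_embedding c 0 = Inl (c mod 21)" "hexagon_embedding c 1 = Inr (c mod 21)"
        "hexagon_embedding c 2 = Inl ((c + 14) mod 21)" "hexagon_embedding c 3 = Inr ((c + 14) mod 21)"
        "hexagon_embedding c 4 = Inl ((c + 7) mod 21)" "hexagon_embedding c 5 = Inr ((c + 7) mod 21)"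
        using wrap by (simp_all add: hexagon_embedding_def)
      have d: "(c mod 21 + 0) mod 21 = c mod 21" "((c + 7) mod 21 + 0) mod 21 = (c + 7) mod 21"
        "((c + 14) mod 21 + 0) mod 21 = (c + 14) mod 21" "(c mod 21 + 14) mod 21 = (c + 14) mod 21"
        "((c + 7) mod 21 + 14) mod 21 = c mod 21" "((c + 14) mod 21 + 14) mod 21 = (c + 7) mod 21"
        using wrap by (simp_all add: mod_add_left_eq add.commute[of 28 c])
      define E where "E m d = {Inl (((c + m) mod 21 + d) mod 21), Inr ((c + m) mod 21)}" for m d
      have "hexagon_embedding c ` {0, 1} = E 0 0" "hexagon_embedding c ` {2, 1} = E 0 14"
        "hexagon_embedding c ` {2, 3} = E 14 0" "hexagon_embedding c ` {4, 3} = E 14 14"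
        "hexagon_embedding c ` {4, 5} = E 7 0" "hexagon_embedding c ` {0, 5} = E 7 14"
        by (simp_all only: image_insert image_empty h E_def add_0_right d mod_mod_trivial)
      then have "(`) (hexagon_embedding c) ` edges ?H = {E 0 0, E 0 14, E 14 0, E 14 14, E 7 0, E 7 14}"
        unfolding edges by (simp only: image_insert[where f = "(`) _"] image_empty[where f = "(`) _"])
      also have "\<dots> = (\<Union>m\<in>{0, 7, 14}. \<Union>d\<in>{0, 14}. {E m d})" by auto
      finally show ?thesis unfolding E_def .
    qed
    have line: "\<exists>c<7. \<exists>m\<in>{0, 7, 14}. l = (c + m) mod 21" if "l < 21" for l :: nat
    proof -
      have "l div 7 < 3" using that by (simp add: less_mult_imp_div_less)
      then have "7 * (l div 7) \<in> {0, 7, 14}" by auto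
      moreover have "l = (l mod 7 + 7 * (l div 7)) mod 21" using that by simp
      moreover have "l mod 7 < 7" by simp
      ultimately show ?thesis by blast
    qed
    have "?F = (\<Union>l<21. \<Union>d\<in>{0, 14}. {{Inl ((l + d) mod 21), Inr l}})" by blast
    also have "{..<21 :: nat} = (\<Union>c<7. \<Union>m\<in>{0, 7, 14}. {(c + m) mod 21})"
    proof (intro equalityI subsetI)
      fix l :: nat assume "l \<in> {..<21}"
      then show "l \<in> (\<Union>c<7. \<Union>m\<in>{0, 7, 14}. {(c + m) mod 21})" using line[of l] by blast
    qed auto
    finally show ?thesis
      unfolding image by (simp only: UN_UN_flatten UN_insert UN_empty Un_empty_right UN_Un)
  qed
  ultimately show ?thesis by (simp add: edge_partition_by_copies_def)
qed


section \<open>The coloring of the cage\<close>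

theorem theorem50:
  shows "\<exists>\<mu>. semi_total_coloring cage_5_6 \<mu> \<and>
     disjoint_copies 3 heawood_graph (edge_induced (equal_end_edges cage_5_6 \<mu>)) \<and>
     disjoint_copies 7 (cycle_graph 6) (edge_induced (edges cage_5_6 - equal_end_edges cage_5_6 \<mu>))"
proof -
  obtain f where f: "bij_betw f (verts singer21) (verts cage_5_6)" "edges cage_5_6 = (`) f ` edges singer21"
    using cage_singer unfolding graph_iso_def by blast
  have wf: "\<forall>e\<in>edges singer21. e \<subseteq> verts singer21" by (auto dest: difference_graph_edges_subset)
  have inj: "inj_on f (verts singer21)" using f(1) by (rule bij_betw_imp_inj_on)
  let ?E = "equal_end_edges singer21 singer_coloring"
  have sub: "?E \<subseteq> edges singer21" by (auto simp: equal_end_edges_def)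
  have "semi_total_coloring singer21 singer_coloring"
    by (rule semi_total_coloring_singer21)
      (rule trans[OF max_degree_graph_iso[OF wf f, symmetric] max_degree_cage_5_6])
  then obtain \<nu> where \<nu>: "semi_total_coloring cage_5_6 \<nu>" "equal_end_edges cage_5_6 \<nu> = (`) f ` ?E"
    by (rule semi_total_coloring_graph_iso[OF wf f])
  have "inj_on ((`) f) (edges singer21)"
    by (rule inj_on_subset[OF inj_on_image_Pow[OF inj]]) (use wf in auto)
  then have diff: "edges cage_5_6 - equal_end_edges cage_5_6 \<nu> = (`) f ` (edges singer21 - ?E)"
    using sub by (simp add: \<nu>(2) f(2) inj_on_image_set_diff)
  have "inj_on f (\<Union>?E)" "inj_on f (\<Union>(edges singer21 - ?E))"
    by (rule inj_on_subset[OF inj]; use wf sub in blast)+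
  note embed = edge_partition_by_copies_comp[OF _ this(1)] edge_partition_by_copies_comp[OF _ this(2)]
  have fanos: "edge_partition_by_copies 3 (difference_graph 7 {0, 1, 5}) (\<lambda>i. f \<circ> fano_embedding i)
      (equal_end_edges cage_5_6 \<nu>)"
    unfolding \<nu>(2) by (rule embed(1), unfold equal_end_edges_singer21(1), rule fano_copies)
  have hexagons: "edge_partition_by_copies 7 (cycle_graph 6) (\<lambda>i. f \<circ> hexagon_embedding i)
      (edges cage_5_6 - equal_end_edges cage_5_6 \<nu>)"
    unfolding diff by (rule embed(2), unfold equal_end_edges_singer21(2), rule hexagon_copies)
  have "graph_iso (cycle_graph 6) (cycle_graph 6)"
    unfolding graph_iso_def by (intro exI[of _ id]) simp
  with hexagons have "disjoint_copies 7 (cycle_graph 6) (edge_induced (edges cage_5_6 - equal_end_edges cage_5_6 \<nu>))"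
    by (rule disjoint_copies_if_edge_partition)
  with \<nu>(1) disjoint_copies_if_edge_partition[OF fanos heawood_singer] show ?thesis by blast
qed

end
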